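(* Let $\{u=F(x,y),\ v=G(x,y)\}\subset\mathbb{R}^4$ be a real-analytic surface germ at the origin with $F=F_2+O(3)$, $G=G_2+O(3)$, whose quadratic parts $F_2,G_2$ are linearly independent (the non-parallel case). Then, through an invertible linear transformation of $\mathbb{R}^4$, the germ can be brought to one of the following three forms at order 2: $$\textbf{(2e)}\quad u=xy+O_{x,y}(3),\quad v=x^2+O_{x,y}(3);$$ $$\textbf{(2f)}\quad u=xy+O_{x,y}(3),\quad v=x^2+y^2+O_{x,y}(3);$$ $$\textbf{(2g)}\quad u=xy+O_{x,y}(3),\quad v=x^2-y^2+O_{x,y}(3).$$ Moreover these three forms are pairwise nonequivalent: no affine transformation of $\mathbb{R}^4$ fixing the origin maps a germ of one of these three forms to a germ of another one.
   Context: Surfaces are germs at the origin of real-analytic graphs over the $(x,y)$-plane in $\mathbb{R}^4\ni(x,y,u,v)$, and equivalences are affine transformations of $\mathbb{R}^4$ fixing the origin (i.e. elements of $\mathrm{GL}(4,\mathbb{R})$) mapping one germ to the other. $O_{x,y}(k)$ denotes a convergent power series all of whose monomials have total degree at least $k$. $F_2=F_{2,0}x^2+F_{1,1}xy+F_{0,2}y^2$ and $G_2=G_{2,0}x^2+G_{1,1}xy+G_{0,2}y^2$ are the homogeneous quadratic parts. *)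

theory Defs
  imports "HOL-Analysis.Analysis"
begin

text \<open>
  Germs of functions of \<open>(x, y)\<close> at the origin are represented by total functions; everything
  below depends only on the values in a neighbourhood of the origin.
\<close>

definition has_power_series ::
    "(nat \<Rightarrow> nat \<Rightarrow> real) \<Rightarrow> (real \<Rightarrow> real \<Rightarrow> real) \<Rightarrow> bool" where
  "has_power_series a f \<longleftrightarrow>
     (\<exists>\<rho>>0. \<forall>x y. \<bar>x\<bar> < \<rho> \<longrightarrow> \<bar>y\<bar> < \<rho> \<longrightarrow>
        ((\<lambda>(i, j). a i j * x ^ i * y ^ j) has_sum f x y) UNIV)"

definition real_analytic_germ :: "(real \<Rightarrow> real \<Rightarrow> real) \<Rightarrow> bool" where
  "real_analytic_germ f \<longleftrightarrow> (\<exists>a. has_power_series a f)"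

text \<open>\<open>O_xy k f\<close> says that \<open>f\<close> is an \<open>O\<^sub>x\<^sub>,\<^sub>y(k)\<close>; hence \<open>f = g + O\<^sub>x\<^sub>,\<^sub>y(k)\<close> is
  \<open>O_xy k (\<lambda>x y. f x y - g x y)\<close>.\<close>

definition O_xy :: "nat \<Rightarrow> (real \<Rightarrow> real \<Rightarrow> real) \<Rightarrow> bool" where
  "O_xy k f \<longleftrightarrow>
     (\<exists>a. has_power_series a f \<and> (\<forall>i j. i + j < k \<longrightarrow> a i j = 0))"

definition quad_form :: "real \<Rightarrow> real \<Rightarrow> real \<Rightarrow> real \<Rightarrow> real \<Rightarrow> real" where
  "quad_form p q r x y = p * x\<^sup>2 + q * x * y + r * y\<^sup>2"

text \<open>Linear independence of a pair (not of the set \<open>{f, g}\<close>, which collapses if \<open>f = g\<close>).\<close>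

definition lin_indep_pair ::
    "(real \<Rightarrow> real \<Rightarrow> real) \<Rightarrow> (real \<Rightarrow> real \<Rightarrow> real) \<Rightarrow> bool" where
  "lin_indep_pair f g \<longleftrightarrow>
     (\<forall>c d. (\<forall>x y. c * f x y + d * g x y = 0) \<longrightarrow> c = 0 \<and> d = 0)"

text \<open>Coordinates of \<open>real^4\<close> are ordered as \<open>(x, y, u, v)\<close>.\<close>

definition graph_surface ::
    "(real \<Rightarrow> real \<Rightarrow> real) \<Rightarrow> (real \<Rightarrow> real \<Rightarrow> real) \<Rightarrow> (real^4) set" where
  "graph_surface F G = {vector [x, y, F x y, G x y] | x y. True}"

definition same_germ :: "(real^4) set \<Rightarrow> (real^4) set \<Rightarrow> bool" where
  "same_germ S T \<longleftrightarrow> (\<forall>\<^sub>F z in nhds 0. z \<in> S \<longleftrightarrow> z \<in> T)"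

definition maps_germ :: "real^4^4 \<Rightarrow> (real^4) set \<Rightarrow> (real^4) set \<Rightarrow> bool" where
  "maps_germ A S T \<longleftrightarrow> same_germ ((\<lambda>z. A *v z) ` S) T"

text \<open>Affine transformations fixing the origin are exactly the elements of \<open>GL(4, \<real>)\<close>.\<close>

definition germs_equivalent :: "(real^4) set \<Rightarrow> (real^4) set \<Rightarrow> bool" where
  "germs_equivalent S T \<longleftrightarrow> (\<exists>A :: real^4^4. invertible A \<and> maps_germ A S T)"

datatype order2_form = Form2e | Form2f | Form2g

fun form_v :: "order2_form \<Rightarrow> real \<Rightarrow> real \<Rightarrow> real" where
  "form_v Form2e x y = x\<^sup>2"
| "form_v Form2f x y = x\<^sup>2 + y\<^sup>2"
| "form_v Form2g x y = x\<^sup>2 - y\<^sup>2"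

definition has_form ::
    "order2_form \<Rightarrow> (real \<Rightarrow> real \<Rightarrow> real) \<Rightarrow> (real \<Rightarrow> real \<Rightarrow> real) \<Rightarrow> bool" where
  "has_form k F G \<longleftrightarrow>
     O_xy 3 (\<lambda>x y. F x y - x * y) \<and> O_xy 3 (\<lambda>x y. G x y - form_v k x y)"

end

theory Submission
  imports Defs
begin

text \<open>
  A linear map \<open>A\<close> of \<open>\<real>\<^sup>4\<close> that carries one such graph germ to another preserves their common tangent
  plane \<open>u = v = 0\<close>, so it is block triangular, with an invertible block \<open>P\<close> acting on \<open>(x, y)\<close> and
  an invertible block \<open>Q\<close> acting on \<open>(u, v)\<close>. At order 2 only these blocks matter: the quadratic parts
  satisfy \<open>Q (F\<^sub>2, G\<^sub>2) = (F\<^sub>2', G\<^sub>2') \<circ> P\<close>. The problem is therefore the classification of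
  two-dimensional spaces (pencils) of binary quadratic forms under linear substitution.

  Existence of a normal form. A pencil in the three-dimensional space of forms
  \<open>p x\<^sup>2 + q x y + r y\<^sup>2\<close> is the kernel of a nonzero linear functional
  \<open>\<alpha> p + \<beta> q + \<gamma> r\<close>, that is, of the pairing with a symmetric matrix with rows \<open>(\<alpha>, \<beta>)\<close>, \<open>(\<beta>, \<gamma>)\<close>.
  Diagonalizing this matrix and rescaling turns the condition into \<open>r = w p\<close> with
  \<open>w \<in> {0, 1, -1}\<close> (\<open>diagonalize_annihilator\<close>), and its kernel is spanned by \<open>x y\<close> and
  \<open>x\<^sup>2 + w y\<^sup>2\<close>; these are the three normal forms. A substitution in \<open>(x, y)\<close> and an invertible
  combination of \<open>u\<close> and \<open>v\<close> achieve this on the whole germ, because terms of order 3 stay of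
  order 3 under both operations (\<open>O_xy_linear_change\<close>, \<open>O_xy_linear_combination\<close>).

  Inequivalence. On the pencil spanned by \<open>x y\<close> and \<open>x\<^sup>2 + w y\<^sup>2\<close>, the discriminant is itself a
  quadratic form in the two coefficients, namely \<open>m\<^sup>2 - 4 w s\<^sup>2\<close> for \<open>m x y + s (x\<^sup>2 + w y\<^sup>2)\<close>. A
  substitution multiplies it by a positive factor, and \<open>Q\<close> changes the basis of the pencil, so the
  sign of its determinant \<open>-4 w\<close> is an invariant of the germ (\<open>pencil_discriminant\<close>), and it tells
  the three forms apart. The equation between quadratic parts comes from following the image of the
  curve \<open>t \<mapsto> (t x, t y, F (t x) (t y), G (t x) (t y))\<close> as \<open>t \<rightarrow> 0\<close> (\<open>second_order_of_germ_map\<close>).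
\<close>

section \<open>Power series germs\<close>

text \<open>
  Expanding \<open>(a x + b y)\<^sup>i (c x + d y)\<^sup>j\<close> by the binomial theorem turns the series into one indexed by
  quadruples \<open>(i, j, k, l)\<close> with \<open>k \<le> i\<close> and \<open>l \<le> j\<close>. It converges absolutely, since the absolute
  values add up to the majorant series at \<open>(\<bar>a\<bar>\<bar>x\<bar> + \<bar>b\<bar>\<bar>y\<bar>, \<bar>c\<bar>\<bar>x\<bar> + \<bar>d\<bar>\<bar>y\<bar>)\<close>, so it may be regrouped by the
  resulting monomial. Each group is finite and keeps the total degree \<open>i + j\<close>, which is why the
  order does not drop.
\<close>

lemma O_xy_linear_change:
  assumes "O_xy n f"
  shows "O_xy n (\<lambda>x y. f (a * x + b * y) (c * x + d * y))"
proof -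
  obtain \<alpha> \<rho> where "\<rho> > 0" and van: "\<And>i j. i + j < n \<Longrightarrow> \<alpha> i j = 0"
    and sum: "\<And>x y. \<bar>x\<bar> < \<rho> \<Longrightarrow> \<bar>y\<bar> < \<rho> \<Longrightarrow> ((\<lambda>(i, j). \<alpha> i j * x ^ i * y ^ j) has_sum f x y) UNIV"
    using assms unfolding O_xy_def has_power_series_def by blast
  define B :: "((nat \<times> nat) \<times> (nat \<times> nat)) set"
    where "B = Sigma UNIV (\<lambda>(i, j). {..i} \<times> {..j})"
  \<comment> \<open>\<open>\<phi>\<close> gives the exponents of the monomial that the term with index \<open>(i, j, k, l)\<close> contributes to,
    and \<open>\<gamma>\<close> gives its coefficient.\<close>
  define \<phi> :: "(nat \<times> nat) \<times> (nat \<times> nat) \<Rightarrow> nat \<times> nat"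
    where "\<phi> = (\<lambda>((i, j), (k, l)). (k + l, i + j - (k + l)))"
  define fib where "fib = (\<lambda>mn. {p \<in> B. \<phi> p = mn})"
  define \<gamma> :: "(nat \<times> nat) \<times> (nat \<times> nat) \<Rightarrow> real"
    where "\<gamma> = (\<lambda>((i, j), (k, l)). \<alpha> i j * (of_nat (i choose k) * a ^ k * b ^ (i - k))
                                     * (of_nat (j choose l) * c ^ l * d ^ (j - l)))"
  define \<beta> where "\<beta> = (\<lambda>m n. \<Sum>p\<in>fib (m, n). \<gamma> p)"
  have fin: "finite (fib mn)" for mn
  proof -
    obtain m n where "mn = (m, n)" by (cases mn)
    then have "fib mn \<subseteq> ({..m+n} \<times> {..m+n}) \<times> ({..m+n} \<times> {..m+n})"
      unfolding fib_def B_def \<phi>_def by auto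
    then show ?thesis by (rule finite_subset) simp
  qed
  have "\<forall>m k. m + k < n \<longrightarrow> \<beta> m k = 0"
    unfolding \<beta>_def
  proof (intro allI impI sum.neutral ballI)
    fix m k p assume "m + k < n" "p \<in> fib (m, k)"
    then obtain i j k' l where "p = ((i, j), (k', l))" "i + j = m + k"
      unfolding fib_def B_def \<phi>_def by auto
    then show "\<gamma> p = 0" using van \<open>m + k < n\<close> unfolding \<gamma>_def by simp
  qed
  moreover have "has_power_series \<beta> (\<lambda>x y. f (a * x + b * y) (c * x + d * y))"
  proof -
    \<comment> \<open>The summand 1 keeps \<open>M\<close> positive and makes the estimate of the new arguments by \<open>\<rho>\<close> strict.\<close>
    define M where "M = 1 + \<bar>a\<bar> + \<bar>b\<bar> + \<bar>c\<bar> + \<bar>d\<bar>"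
    have "M > 0" unfolding M_def by simp
    have "((\<lambda>(i, j). \<beta> i j * x ^ i * y ^ j) has_sum f (a * x + b * y) (c * x + d * y)) UNIV"
      if x: "\<bar>x\<bar> < \<rho> / M" and y: "\<bar>y\<bar> < \<rho> / M" for x y
    proof -
      define X Y where "X = \<bar>a\<bar> * \<bar>x\<bar> + \<bar>b\<bar> * \<bar>y\<bar>" and "Y = \<bar>c\<bar> * \<bar>x\<bar> + \<bar>d\<bar> * \<bar>y\<bar>"
      have lt: "\<bar>s\<bar> * \<bar>x\<bar> + \<bar>t\<bar> * \<bar>y\<bar> < \<rho>" if "\<bar>s\<bar> + \<bar>t\<bar> < M" for s t
      proof -
        have "\<bar>s\<bar> * \<bar>x\<bar> + \<bar>t\<bar> * \<bar>y\<bar> \<le> \<bar>s\<bar> * (\<rho> / M) + \<bar>t\<bar> * (\<rho> / M)"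
          using x y by (intro add_mono mult_left_mono) auto
        also have "\<dots> = (\<bar>s\<bar> + \<bar>t\<bar>) * (\<rho> / M)" by (simp add: algebra_simps)
        also have "\<dots> < M * (\<rho> / M)"
          using that \<open>\<rho> > 0\<close> \<open>M > 0\<close> by (intro mult_strict_right_mono) auto
        finally show ?thesis using \<open>M > 0\<close> by simp
      qed
      have "X < \<rho>" "Y < \<rho>" "X \<ge> 0" "Y \<ge> 0"
        unfolding X_def Y_def by (auto intro!: lt simp: M_def)
      have X: "\<bar>a * x + b * y\<bar> \<le> X" and Y: "\<bar>c * x + d * y\<bar> \<le> Y"
        unfolding X_def Y_def by (metis abs_mult abs_triangle_ineq)+
      define T where "T = (\<lambda>((i, j), (k, l)).
        \<alpha> i j * (of_nat (i choose k) * (a * x) ^ k * (b * y) ^ (i - k))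
              * (of_nat (j choose l) * (c * x) ^ l * (d * y) ^ (j - l)))"
      have split: "(\<Sum>(k, l)\<in>{..i} \<times> {..j}. h k * g l) = sum h {..i} * sum g {..j}"
        for h g :: "nat \<Rightarrow> real" and i j
        by (simp add: sum_product sum.cartesian_product)
      have inner: "(\<Sum>q\<in>{..i} \<times> {..j}. T ((i, j), q))
          = \<alpha> i j * (a * x + b * y) ^ i * (c * x + d * y) ^ j" for i j
        unfolding binomial_ring mult.assoc split[symmetric] T_def
        by (simp add: sum_distrib_left case_prod_unfold mult_ac)
      have inner_abs: "(\<Sum>q\<in>{..i} \<times> {..j}. \<bar>T ((i, j), q)\<bar>) = \<bar>\<alpha> i j\<bar> * X ^ i * Y ^ j" for i j
        unfolding X_def Y_def binomial_ring mult.assoc split[symmetric] T_def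
        by (simp add: sum_distrib_left case_prod_unfold mult_ac abs_mult power_abs power_mult_distrib)
      have "(\<lambda>(i, j). \<alpha> i j * X ^ i * Y ^ j) summable_on UNIV"
        using sum[of X Y] \<open>X < \<rho>\<close> \<open>Y < \<rho>\<close> \<open>X \<ge> 0\<close> \<open>Y \<ge> 0\<close> by (auto intro: has_sum_imp_summable)
      then have "(\<lambda>p. norm (case p of (i, j) \<Rightarrow> \<alpha> i j * X ^ i * Y ^ j)) summable_on UNIV"
        by (rule summable_on_iff_abs_summable_on_real[THEN iffD1])
      then have outer: "(\<lambda>(i, j). \<bar>\<alpha> i j\<bar> * X ^ i * Y ^ j) summable_on UNIV"
        using \<open>X \<ge> 0\<close> \<open>Y \<ge> 0\<close> by (simp add: case_prod_unfold abs_mult)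
      have "(\<lambda>p. \<bar>T p\<bar>) summable_on B"
        unfolding B_def
      proof (rule summable_on_SigmaI[OF _ outer])
        fix ij :: "nat \<times> nat"
        obtain i j where ij: "ij = (i, j)" by (cases ij)
        show "((\<lambda>q. \<bar>T (ij, q)\<bar>) has_sum (case ij of (i, j) \<Rightarrow> \<bar>\<alpha> i j\<bar> * X ^ i * Y ^ j))
                (case ij of (i, j) \<Rightarrow> {..i} \<times> {..j})"
          unfolding ij using inner_abs[of i j] has_sum_finite[of "{..i} \<times> {..j}" "\<lambda>q. \<bar>T ((i, j), q)\<bar>"]
          by simp
      qed simp
      then have "T summable_on B"
        using abs_summable_summable[of T B] by simp
      have "(T has_sum f (a * x + b * y) (c * x + d * y)) B"
        unfolding B_def
      proof (rule has_sum_SigmaI)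
        show "((\<lambda>(i, j). \<alpha> i j * (a * x + b * y) ^ i * (c * x + d * y) ^ j)
                 has_sum f (a * x + b * y) (c * x + d * y)) UNIV"
          using X Y \<open>X < \<rho>\<close> \<open>Y < \<rho>\<close> by (intro sum) auto
        show "T summable_on Sigma UNIV (\<lambda>(i, j). {..i} \<times> {..j})"
          using \<open>T summable_on B\<close> unfolding B_def .
        fix ij :: "nat \<times> nat"
        obtain i j where ij: "ij = (i, j)" by (cases ij)
        show "((\<lambda>q. T (ij, q)) has_sum
                (case ij of (i, j) \<Rightarrow> \<alpha> i j * (a * x + b * y) ^ i * (c * x + d * y) ^ j))
                (case ij of (i, j) \<Rightarrow> {..i} \<times> {..j})"
          unfolding ij using inner[of i j] has_sum_finite[of "{..i} \<times> {..j}" "\<lambda>q. T ((i, j), q)"]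
          by simp
      qed
      \<comment> \<open>The fibres of \<open>\<phi>\<close> partition the index set, so the sum can be taken fibre by fibre.\<close>
      moreover have "bij_betw snd (Sigma UNIV fib) B"
        by (rule bij_betwI[where g = "\<lambda>p. (\<phi> p, p)"]) (auto simp: fib_def)
      ultimately have "((\<lambda>p. T (snd p)) has_sum f (a * x + b * y) (c * x + d * y)) (Sigma UNIV fib)"
        by (simp add: has_sum_reindex_bij_betw)
      then show ?thesis
      proof (rule has_sum_SigmaD)
        fix mn :: "nat \<times> nat"
        obtain m n where mn: "mn = (m, n)" by (cases mn)
        have "T p = \<gamma> p * x ^ m * y ^ n" if "p \<in> fib (m, n)" for p
        proof -
          obtain i j k l where p: "p = ((i, j), (k, l))" by (metis surj_pair)
          have "k \<le> i" "l \<le> j" and mn: "m = k + l" "n = (i - k) + (j - l)"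
            using that unfolding p fib_def B_def \<phi>_def by auto
          show ?thesis
            unfolding p mn T_def \<gamma>_def by (simp add: power_mult_distrib power_add mult_ac)
        qed
        then have "(\<Sum>p\<in>fib (m, n). T p) = \<beta> m n * x ^ m * y ^ n"
          unfolding \<beta>_def sum_distrib_right by (intro sum.cong) auto
        then show "((\<lambda>p. T (snd (mn, p))) has_sum (case mn of (i, j) \<Rightarrow> \<beta> i j * x ^ i * y ^ j)) (fib mn)"
          unfolding mn using has_sum_finite[OF fin, of T "(m, n)"] by simp
      qed
    qed
    then show ?thesis
      unfolding has_power_series_def using \<open>\<rho> > 0\<close> \<open>M > 0\<close> by (intro exI[of _ "\<rho> / M"]) auto
  qed
  ultimately show ?thesis unfolding O_xy_def by (intro exI[of _ \<beta>] conjI)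
qed

lemma O_xy_linear_combination:
  assumes "O_xy n f" "O_xy n g"
  shows "O_xy n (\<lambda>x y. s * f x y + t * g x y)"
proof -
  obtain \<alpha> \<rho> where "\<rho> > 0" and van_f: "\<And>i j. i + j < n \<Longrightarrow> \<alpha> i j = 0"
    and sum_f: "\<And>x y. \<bar>x\<bar> < \<rho> \<Longrightarrow> \<bar>y\<bar> < \<rho> \<Longrightarrow> ((\<lambda>(i, j). \<alpha> i j * x ^ i * y ^ j) has_sum f x y) UNIV"
    using assms(1) unfolding O_xy_def has_power_series_def by blast
  obtain \<beta> \<sigma> where "\<sigma> > 0" and van_g: "\<And>i j. i + j < n \<Longrightarrow> \<beta> i j = 0"
    and sum_g: "\<And>x y. \<bar>x\<bar> < \<sigma> \<Longrightarrow> \<bar>y\<bar> < \<sigma> \<Longrightarrow> ((\<lambda>(i, j). \<beta> i j * x ^ i * y ^ j) has_sum g x y) UNIV"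
    using assms(2) unfolding O_xy_def has_power_series_def by blast
  have "((\<lambda>(i, j). (s * \<alpha> i j + t * \<beta> i j) * x ^ i * y ^ j) has_sum s * f x y + t * g x y) UNIV"
    if "\<bar>x\<bar> < min \<rho> \<sigma>" "\<bar>y\<bar> < min \<rho> \<sigma>" for x y
  proof -
    have "((\<lambda>p. s * (case p of (i, j) \<Rightarrow> \<alpha> i j * x ^ i * y ^ j)
              + t * (case p of (i, j) \<Rightarrow> \<beta> i j * x ^ i * y ^ j)) has_sum s * f x y + t * g x y) UNIV"
      using that by (intro has_sum_add has_sum_cmult_right sum_f sum_g) auto
    then show ?thesis by (simp add: case_prod_unfold algebra_simps)
  qed
  then have "has_power_series (\<lambda>i j. s * \<alpha> i j + t * \<beta> i j) (\<lambda>x y. s * f x y + t * g x y)"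
    unfolding has_power_series_def using \<open>\<rho> > 0\<close> \<open>\<sigma> > 0\<close>
    by (intro exI[of _ "min \<rho> \<sigma>"]) auto
  then show ?thesis
    unfolding O_xy_def using van_f van_g
    by (intro exI[of _ "\<lambda>i j. s * \<alpha> i j + t * \<beta> i j"] conjI) simp_all
qed

text \<open>
  The series converges absolutely at a point \<open>(r, r)\<close> with \<open>r > 0\<close>. With \<open>s = \<bar>x\<bar> + \<bar>y\<bar> \<le> r\<close>, every
  monomial of degree at least \<open>n\<close> is in absolute value at most \<open>(s / r)\<^sup>n\<close> times its value at \<open>(r, r)\<close>.
\<close>

lemma O_xy_bound:
  assumes "O_xy n f"
  obtains K \<rho> where "\<rho> > 0" "\<And>x y. \<bar>x\<bar> < \<rho> \<Longrightarrow> \<bar>y\<bar> < \<rho> \<Longrightarrow> \<bar>f x y\<bar> \<le> K * (\<bar>x\<bar> + \<bar>y\<bar>) ^ n"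
proof -
  obtain \<alpha> \<rho> where van: "\<And>i j. i + j < n \<Longrightarrow> \<alpha> i j = 0" and "\<rho> > 0"
    and sum: "\<And>x y. \<bar>x\<bar> < \<rho> \<Longrightarrow> \<bar>y\<bar> < \<rho> \<Longrightarrow> ((\<lambda>(i, j). \<alpha> i j * x ^ i * y ^ j) has_sum f x y) UNIV"
    using assms unfolding O_xy_def has_power_series_def by blast
  define r where "r = \<rho> / 2"
  have "r > 0" "r < \<rho>" using \<open>\<rho> > 0\<close> by (auto simp: r_def)
  have "(\<lambda>(i, j). \<alpha> i j * r ^ i * r ^ j) summable_on UNIV"
    using sum[of r r] \<open>r > 0\<close> \<open>r < \<rho>\<close> by (auto intro: has_sum_imp_summable)
  then have "(\<lambda>p. norm (case p of (i, j) \<Rightarrow> \<alpha> i j * r ^ i * r ^ j)) summable_on UNIV"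
    by (rule summable_on_iff_abs_summable_on_real[THEN iffD1])
  then obtain C where C: "((\<lambda>(i, j). \<bar>\<alpha> i j\<bar> * r ^ (i + j)) has_sum C) UNIV"
    using \<open>r > 0\<close> by (auto simp: case_prod_unfold abs_mult power_add mult_ac summable_on_def)
  have "\<bar>f x y\<bar> \<le> C / r ^ n * (\<bar>x\<bar> + \<bar>y\<bar>) ^ n" if "\<bar>x\<bar> < r / 2" "\<bar>y\<bar> < r / 2" for x y
  proof -
    define s where "s = \<bar>x\<bar> + \<bar>y\<bar>"
    have "0 \<le> s" "s \<le> r" using that by (auto simp: s_def)
    have fsum: "((\<lambda>(i, j). \<alpha> i j * x ^ i * y ^ j) has_sum f x y) UNIV"
      using that \<open>r < \<rho>\<close> \<open>r > 0\<close> by (intro sum) linarith+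
    have maj: "((\<lambda>p. (s / r) ^ n * (case p of (i, j) \<Rightarrow> \<bar>\<alpha> i j\<bar> * r ^ (i + j))) has_sum (s / r) ^ n * C) UNIV"
      using C by (rule has_sum_cmult_right)
    have le: "\<bar>case p of (i, j) \<Rightarrow> \<alpha> i j * x ^ i * y ^ j\<bar>
        \<le> (s / r) ^ n * (case p of (i, j) \<Rightarrow> \<bar>\<alpha> i j\<bar> * r ^ (i + j))" for p
    proof -
      obtain i j where p: "p = (i, j)" by (cases p)
      show ?thesis
      proof (cases "i + j < n")
        case True
        then show ?thesis using van p by simp
      next
        case False
        then obtain m where m: "i + j = n + m" by (metis le_Suc_ex not_less)
        have "\<bar>x\<bar> ^ i * \<bar>y\<bar> ^ j \<le> s ^ i * s ^ j"
          by (intro mult_mono power_mono) (auto simp: s_def)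
        also have "\<dots> = s ^ n * s ^ m" using m by (simp flip: power_add)
        also have "\<dots> \<le> s ^ n * r ^ m"
          using \<open>0 \<le> s\<close> \<open>s \<le> r\<close> by (intro mult_left_mono power_mono) auto
        also have "\<dots> = (s / r) ^ n * r ^ (i + j)"
          using \<open>r > 0\<close> m by (simp add: power_divide power_add)
        finally have "\<bar>\<alpha> i j\<bar> * (\<bar>x\<bar> ^ i * \<bar>y\<bar> ^ j) \<le> \<bar>\<alpha> i j\<bar> * ((s / r) ^ n * r ^ (i + j))"
          by (rule mult_left_mono) simp
        then show ?thesis by (simp add: p abs_mult power_abs mult_ac)
      qed
    qed
    have "f x y \<le> (s / r) ^ n * C"
      by (rule has_sum_mono[OF fsum maj]) (use le in \<open>blast intro: order_trans[OF abs_ge_self]\<close>)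
    moreover have "- f x y \<le> (s / r) ^ n * C"
      by (rule has_sum_mono[OF has_sum_uminusI[OF fsum] maj])
        (use le in \<open>blast intro: order_trans[OF abs_ge_minus_self]\<close>)
    ultimately show ?thesis by (simp add: s_def power_divide mult_ac)
  qed
  then show ?thesis using \<open>r > 0\<close> by (intro that[of "r / 2" "C / r ^ n"]) auto
qed

text \<open>
  The curve \<open>(g, h)\<close> only has to have the direction \<open>(X, Y)\<close> at the origin: the cubic remainder is
  \<open>O(t\<^sup>3)\<close> along it, and the quadratic part is homogeneous. This generality is needed because the
  image of a ray under a germ map, projected to the first two coordinates, is no longer a ray.
\<close>

lemma second_order_limit:
  assumes f: "O_xy 3 (\<lambda>x y. f x y - quad_form p q r x y)"
    and g: "((\<lambda>t. g t / t) \<longlongrightarrow> X) (at_right 0)" and h: "((\<lambda>t. h t / t) \<longlongrightarrow> Y) (at_right 0)"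
  shows "((\<lambda>t. f (g t) (h t) / t\<^sup>2) \<longlongrightarrow> quad_form p q r X Y) (at_right 0)"
proof -
  obtain K \<rho> where "\<rho> > 0" and K: "\<And>x y. \<bar>x\<bar> < \<rho> \<Longrightarrow> \<bar>y\<bar> < \<rho> \<Longrightarrow>
      \<bar>f x y - quad_form p q r x y\<bar> \<le> K * (\<bar>x\<bar> + \<bar>y\<bar>) ^ 3"
    by (rule O_xy_bound[OF f]) (rule that)
  have pos: "\<forall>\<^sub>F t in at_right 0. (t::real) > 0"
    by (simp add: eventually_at_right_less)
  have small: "\<forall>\<^sub>F t in at_right 0. \<bar>u t\<bar> < \<rho>" if "((\<lambda>t. u t / t) \<longlongrightarrow> U) (at_right 0)" for u U
  proof -
    have "((\<lambda>t. \<bar>t * (u t / t)\<bar>) \<longlongrightarrow> \<bar>0 * U\<bar>) (at_right 0)"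
      using that by (intro tendsto_intros)
    then have "\<forall>\<^sub>F t in at_right 0. \<bar>t * (u t / t)\<bar> < \<rho>"
      using \<open>\<rho> > 0\<close> by (intro order_tendstoD(2)) auto
    with pos show ?thesis by eventually_elim simp
  qed
  have "((\<lambda>t. K * (\<bar>g t / t\<bar> + \<bar>h t / t\<bar>) ^ 3 * t) \<longlongrightarrow> K * (\<bar>X\<bar> + \<bar>Y\<bar>) ^ 3 * 0) (at_right 0)"
    using g h by (intro tendsto_intros)
  then have maj: "((\<lambda>t. K * (\<bar>g t / t\<bar> + \<bar>h t / t\<bar>) ^ 3 * t) \<longlongrightarrow> 0) (at_right 0)" by simp
  have "((\<lambda>t. (f (g t) (h t) - quad_form p q r (g t) (h t)) / t\<^sup>2) \<longlongrightarrow> 0) (at_right 0)"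
  proof (rule Lim_null_comparison[OF _ maj])
    show "\<forall>\<^sub>F t in at_right 0. norm ((f (g t) (h t) - quad_form p q r (g t) (h t)) / t\<^sup>2)
        \<le> K * (\<bar>g t / t\<bar> + \<bar>h t / t\<bar>) ^ 3 * t"
      using pos small[OF g] small[OF h]
    proof eventually_elim
      case (elim t)
      have "\<bar>f (g t) (h t) - quad_form p q r (g t) (h t)\<bar> / t\<^sup>2 \<le> K * (\<bar>g t\<bar> + \<bar>h t\<bar>) ^ 3 / t\<^sup>2"
        using K elim by (intro divide_right_mono) auto
      also have "\<dots> = K * (\<bar>g t / t\<bar> + \<bar>h t / t\<bar>) ^ 3 * t"
      proof -
        have "\<bar>g t / t\<bar> + \<bar>h t / t\<bar> = (\<bar>g t\<bar> + \<bar>h t\<bar>) / t"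
          using elim by (simp add: add_divide_distrib)
        then show ?thesis using elim by (simp add: power_divide power2_eq_square power3_eq_cube)
      qed
      finally show ?case using elim by (simp add: abs_div)
    qed
  qed
  moreover have "((\<lambda>t. quad_form p q r (g t / t) (h t / t)) \<longlongrightarrow> quad_form p q r X Y) (at_right 0)"
    unfolding quad_form_def using g h by (intro tendsto_intros)
  ultimately have "((\<lambda>t. (f (g t) (h t) - quad_form p q r (g t) (h t)) / t\<^sup>2
      + quad_form p q r (g t / t) (h t / t)) \<longlongrightarrow> 0 + quad_form p q r X Y) (at_right 0)"
    by (rule tendsto_add)
  moreover have "(f (g t) (h t) - quad_form p q r (g t) (h t)) / t\<^sup>2
      + quad_form p q r (g t / t) (h t / t) = f (g t) (h t) / t\<^sup>2" for t
    by (cases "t = 0") (auto simp: quad_form_def field_simps power2_eq_square)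
  ultimately show ?thesis by simp
qed

section \<open>Linear maps between graph germs\<close>

lemma vector_4_nth [simp]:
  "(vector [a, b, c, d] :: 'a::zero^4) $ 1 = a"
  "(vector [a, b, c, d] :: 'a^4) $ 2 = b"
  "(vector [a, b, c, d] :: 'a^4) $ 3 = c"
  "(vector [a, b, c, d] :: 'a^4) $ 4 = d"
  unfolding vector_def by simp_all

lemma mem_graph_surface:
  "z \<in> graph_surface F G \<longleftrightarrow> z $ 3 = F (z $ 1) (z $ 2) \<and> z $ 4 = G (z $ 1) (z $ 2)"
proof
  assume "z $ 3 = F (z $ 1) (z $ 2) \<and> z $ 4 = G (z $ 1) (z $ 2)"
  then have "z = vector [z $ 1, z $ 2, F (z $ 1) (z $ 2), G (z $ 1) (z $ 2)]"
    unfolding vec_eq_iff forall_4 by simp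
  then show "z \<in> graph_surface F G" unfolding graph_surface_def by blast
qed (auto simp: graph_surface_def)

lemma matrix_vector_mult_4:
  fixes A :: "real^4^4"
  shows "(A *v z) $ i = A$i$1 * z$1 + A$i$2 * z$2 + A$i$3 * z$3 + A$i$4 * z$4"
  by (simp add: matrix_vector_mult_def sum_4)

text \<open>
  The target \<open>T\<close> enters only through one of its two equations, \<open>z\<^sub>i = H (z\<^sub>1, z\<^sub>2)\<close>, so that the lemma
  serves both rows \<open>i = 3\<close> and \<open>i = 4\<close>. That equation is evaluated along the image of the curve in the
  source graph above the ray through \<open>(x, y)\<close>, and divided by \<open>t\<close> and by \<open>t\<^sup>2\<close>. The first division gives
  the vanishing of the tangential entries of row \<open>i\<close>, because \<open>H\<close> has no linear terms; only then do the
  remaining terms have a limit after the second.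
\<close>

lemma second_order_of_germ_map:
  fixes A :: "real^4^4"
  assumes F: "O_xy 3 (\<lambda>x y. F x y - quad_form p q r x y)"
    and G: "O_xy 3 (\<lambda>x y. G x y - quad_form p' q' r' x y)"
    and H: "O_xy 3 (\<lambda>x y. H x y - quad_form p'' q'' r'' x y)"
    and maps: "maps_germ A (graph_surface F G) T"
    and T: "\<And>z. z \<in> T \<Longrightarrow> z $ i = H (z $ 1) (z $ 2)"
  shows "A$i$1 = 0" "A$i$2 = 0"
    and "A$i$3 * quad_form p q r x y + A$i$4 * quad_form p' q' r' x y
       = quad_form p'' q'' r'' (A$1$1 * x + A$1$2 * y) (A$2$1 * x + A$2$2 * y)"
proof -
  have main: "A$i$1 * x + A$i$2 * y = 0 \<and>
      A$i$3 * quad_form p q r x y + A$i$4 * quad_form p' q' r' x y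
       = quad_form p'' q'' r'' (A$1$1 * x + A$1$2 * y) (A$2$1 * x + A$2$2 * y)" for x y
  proof -
    define z :: "real \<Rightarrow> real^4" where
      "z = (\<lambda>t. vector [t * x, t * y, F (t * x) (t * y), G (t * x) (t * y)])"
    define w where "w = (\<lambda>t. A *v z t)"
    have pos: "\<forall>\<^sub>F t in at_right 0. (t::real) > 0"
      by (simp add: eventually_at_right_less)
    have id: "((\<lambda>t::real. t) \<longlongrightarrow> 0) (at_right 0)" by (rule tendsto_ident_at)
    have lin: "((\<lambda>t. t * c / t) \<longlongrightarrow> c) (at_right 0)" for c :: real
      by (rule tendsto_eventually) (use pos in eventually_elim, simp)
    have F2: "((\<lambda>t. F (t * x) (t * y) / t\<^sup>2) \<longlongrightarrow> quad_form p q r x y) (at_right 0)"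
      and G2: "((\<lambda>t. G (t * x) (t * y) / t\<^sup>2) \<longlongrightarrow> quad_form p' q' r' x y) (at_right 0)"
      by (rule second_order_limit[OF F lin lin] second_order_limit[OF G lin lin])+
    have lower: "((\<lambda>t. u t / t) \<longlongrightarrow> 0) (at_right 0)" if "((\<lambda>t. u t / t\<^sup>2) \<longlongrightarrow> U) (at_right 0)"
      for u and U :: real
    proof -
      have "((\<lambda>t. t * (u t / t\<^sup>2)) \<longlongrightarrow> 0 * U) (at_right 0)"
        by (intro tendsto_mult id that)
      then have "((\<lambda>t. t * (u t / t\<^sup>2)) \<longlongrightarrow> 0) (at_right 0)" by simp
      then show ?thesis
        by (rule Lim_transform_eventually) (use pos in eventually_elim, simp add: power2_eq_square)
    qed
    have w_nth: "w t $ j = A$j$1 * (t * x) + A$j$2 * (t * y)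
        + A$j$3 * F (t * x) (t * y) + A$j$4 * G (t * x) (t * y)" for t j
      unfolding w_def z_def by (simp add: matrix_vector_mult_4)
    have w1: "((\<lambda>t. w t $ j / t) \<longlongrightarrow> A$j$1 * x + A$j$2 * y) (at_right 0)" for j
    proof -
      have "((\<lambda>t. A$j$1 * (t * x / t) + A$j$2 * (t * y / t)
          + A$j$3 * (F (t * x) (t * y) / t) + A$j$4 * (G (t * x) (t * y) / t))
          \<longlongrightarrow> A$j$1 * x + A$j$2 * y + A$j$3 * 0 + A$j$4 * 0) (at_right 0)"
        by (intro tendsto_intros lin lower[OF F2] lower[OF G2])
      then show ?thesis by (simp add: w_nth add_divide_distrib del: times_divide_eq_right flip: times_divide_eq_right)
    qed
    have "(w \<longlongrightarrow> 0) (at_right 0)"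
    proof (rule vec_tendstoI)
      fix j
      have "((\<lambda>t. t * (w t $ j / t)) \<longlongrightarrow> 0 * (A$j$1 * x + A$j$2 * y)) (at_right 0)"
        by (intro tendsto_mult id w1)
      then have "((\<lambda>t. t * (w t $ j / t)) \<longlongrightarrow> 0 $ j) (at_right 0)" by simp
      then show "((\<lambda>t. w t $ j) \<longlongrightarrow> 0 $ j) (at_right 0)"
        by (rule Lim_transform_eventually) (use pos in eventually_elim, simp)
    qed
    then have "\<forall>\<^sub>F t in at_right 0. w t \<in> (\<lambda>z. A *v z) ` graph_surface F G \<longleftrightarrow> w t \<in> T"
      using maps unfolding maps_germ_def same_germ_def by (rule filterlim_iff[THEN iffD1, rule_format])
    moreover have "w t \<in> (\<lambda>z. A *v z) ` graph_surface F G" for t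
      unfolding w_def z_def graph_surface_def by blast
    ultimately have wT: "\<forall>\<^sub>F t in at_right 0. w t $ i = H (w t $ 1) (w t $ 2)"
      by (auto intro: T elim: eventually_mono)
    have "((\<lambda>t. H (w t $ 1) (w t $ 2) / t\<^sup>2) \<longlongrightarrow>
        quad_form p'' q'' r'' (A$1$1 * x + A$1$2 * y) (A$2$1 * x + A$2$2 * y)) (at_right 0)"
      by (rule second_order_limit[OF H w1 w1])
    then have w2: "((\<lambda>t. w t $ i / t\<^sup>2) \<longlongrightarrow>
        quad_form p'' q'' r'' (A$1$1 * x + A$1$2 * y) (A$2$1 * x + A$2$2 * y)) (at_right 0)"
      by (rule Lim_transform_eventually) (use wT in eventually_elim, simp)
    have 1: "A$i$1 * x + A$i$2 * y = 0"
      using tendsto_unique[OF _ w1 lower[OF w2]] by simp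
    have "w t $ i = t * (A$i$1 * x + A$i$2 * y) + A$i$3 * F (t * x) (t * y) + A$i$4 * G (t * x) (t * y)" for t
      unfolding w_nth by (simp add: algebra_simps)
    then have "w t $ i / t\<^sup>2 = A$i$3 * (F (t * x) (t * y) / t\<^sup>2) + A$i$4 * (G (t * x) (t * y) / t\<^sup>2)" for t
      using 1 by (simp add: add_divide_distrib)
    then have "((\<lambda>t. w t $ i / t\<^sup>2) \<longlongrightarrow>
        A$i$3 * quad_form p q r x y + A$i$4 * quad_form p' q' r' x y) (at_right 0)"
      by (simp only:) (intro tendsto_intros F2 G2)
    from tendsto_unique[OF _ this w2] 1 show ?thesis by simp
  qed
  show "A$i$1 = 0" "A$i$2 = 0"
    using main[of 1 0] main[of 0 1] by auto
  show "A$i$3 * quad_form p q r x y + A$i$4 * quad_form p' q' r' x y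
       = quad_form p'' q'' r'' (A$1$1 * x + A$1$2 * y) (A$2$1 * x + A$2$2 * y)"
    using main by blast
qed

text \<open>
  The substitution in the graph functions is the inverse of the block that acts on \<open>(x, y)\<close>: that
  block maps \<open>(a x + b y, c x + d y)\<close> to \<open>(x, y)\<close>. Since the matrix is block diagonal, it maps the
  whole graph onto a graph, not merely the germ.
\<close>

lemma block_linear_change_of_graph:
  assumes e: "a * d - b * c \<noteq> 0" and \<delta>: "k1 * k4 - k2 * k3 \<noteq> (0::real)"
  shows "germs_equivalent (graph_surface F G)
    (graph_surface
      (\<lambda>x y. k1 * F (a * x + b * y) (c * x + d * y) + k2 * G (a * x + b * y) (c * x + d * y))
      (\<lambda>x y. k3 * F (a * x + b * y) (c * x + d * y) + k4 * G (a * x + b * y) (c * x + d * y)))"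
    (is "germs_equivalent ?S ?T")
proof -
  define e where "e = a * d - b * c"
  have "e \<noteq> 0" using e by (simp add: e_def)
  define A :: "real^4^4" where
    "A = vector [vector [d / e, - b / e, 0, 0], vector [- c / e, a / e, 0, 0],
                 vector [0, 0, k1, k2], vector [0, 0, k3, k4]]"
  have A: "A *v z = vector [(d * z$1 - b * z$2) / e, (a * z$2 - c * z$1) / e,
      k1 * z$3 + k2 * z$4, k3 * z$3 + k4 * z$4]" for z
    unfolding vec_eq_iff forall_4 by (simp add: matrix_vector_mult_4 A_def diff_divide_distrib)
  have cancel: "a * ((d * x - b * y) / e) + b * ((a * y - c * x) / e) = x"
    "c * ((d * x - b * y) / e) + d * ((a * y - c * x) / e) = y"
    "(d * (a * x + b * y) - b * (c * x + d * y)) / e = x"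
    "(a * (c * x + d * y) - c * (a * x + b * y)) / e = y" for x y
    using \<open>e \<noteq> 0\<close> by (auto simp: field_simps) (auto simp: e_def algebra_simps)
  have "z = 0" if "A *v z = 0" for z
  proof -
    have z: "(d * z$1 - b * z$2) / e = 0" "(a * z$2 - c * z$1) / e = 0"
      "k1 * z$3 + k2 * z$4 = 0" "k3 * z$3 + k4 * z$4 = 0"
      using that unfolding A vec_eq_iff forall_4 by simp_all
    have "z$1 = 0" "z$2 = 0" using cancel(1,2)[of "z$1" "z$2"] unfolding z by simp_all
    moreover have "(k1 * k4 - k2 * k3) * z$3 = 0" "(k1 * k4 - k2 * k3) * z$4 = 0"
      using z(3,4) by algebra+
    ultimately show ?thesis using \<delta> unfolding vec_eq_iff forall_4 by simp
  qed
  then have "invertible A"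
    unfolding invertible_left_inverse matrix_left_invertible_ker by blast
  moreover have "(\<lambda>z. A *v z) ` ?S = ?T"
  proof (intro set_eqI iffI)
    fix w assume "w \<in> (\<lambda>z. A *v z) ` ?S"
    then obtain z where "w = A *v z" "z \<in> ?S" by blast
    then show "w \<in> ?T"
      unfolding mem_graph_surface A by (simp add: cancel del: times_divide_eq_right)
  next
    fix w assume w: "w \<in> ?T"
    define z :: "real^4" where "z = (let X = a * w$1 + b * w$2; Y = c * w$1 + d * w$2
      in vector [X, Y, F X Y, G X Y])"
    have "z \<in> ?S" unfolding mem_graph_surface z_def Let_def by simp
    moreover have "w = A *v z"
      using w unfolding mem_graph_surface A vec_eq_iff forall_4 z_def Let_def by (simp add: cancel)
    ultimately show "w \<in> (\<lambda>z. A *v z) ` ?S" by blast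
  qed
  ultimately show ?thesis
    unfolding germs_equivalent_def maps_germ_def same_germ_def by (intro exI[of _ A]) simp
qed

section \<open>Pencils of binary quadratic forms\<close>

text \<open>The weight \<open>w\<close> with which the second component of the form reads \<open>x\<^sup>2 + w y\<^sup>2\<close>.\<close>

fun form_weight :: "order2_form \<Rightarrow> real" where
  "form_weight Form2e = 0"
| "form_weight Form2f = 1"
| "form_weight Form2g = -1"

lemma form_v_eq_quad_form: "form_v k = quad_form 1 0 (form_weight k)"
  by (cases k) (auto simp: fun_eq_iff quad_form_def)

lemma xy_eq_quad_form: "(\<lambda>x y. x * y) = quad_form 0 1 0"
  by (auto simp: fun_eq_iff quad_form_def)

lemma quad_form_linear_change:
  "quad_form p q r (a * x + b * y) (c * x + d * y)
   = quad_form (quad_form p q r a c) (2 * p * a * b + q * (a * d + b * c) + 2 * r * c * d)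
       (quad_form p q r b d) x y"
  by (simp add: quad_form_def power2_eq_square algebra_simps)

lemma exists_form_weight:
  fixes s :: real
  obtains k c where "c \<noteq> 0" "s = form_weight k * c\<^sup>2"
proof (cases s "0::real" rule: linorder_cases)
  case less
  then show ?thesis by (intro that[of "sqrt (- s)" Form2g]) auto
next
  case equal
  then show ?thesis by (intro that[of 1 Form2e]) auto
next
  case greater
  then show ?thesis by (intro that[of "sqrt s" Form2f]) auto
qed

text \<open>
  The conclusion says that the functional becomes \<open>r - w p\<close>, up to a scalar, in the coordinates given by
  \<open>(x, y) = (a x' + b y', c x' + d y')\<close>, since \<open>p' = quad_form p q r a c\<close> and \<open>r' = quad_form p q r b d\<close>
  are the new coefficients of the squares. In matrix terms, the symmetric matrix of \<open>(\<alpha>, \<beta>, \<gamma>)\<close> is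
  proportional to \<open>e e\<^sup>T - w f f\<^sup>T\<close> with \<open>e = (b, d)\<close> and \<open>f = (a, c)\<close>. If a diagonal entry is nonzero,
  completing the square gives this decomposition; if both vanish, the functional is a multiple of
  \<open>q\<close>, and \<open>e = (1, -1)\<close>, \<open>f = (1, 1)\<close> work with \<open>w = 1\<close>.
\<close>

lemma diagonalize_annihilator:
  fixes \<alpha> \<beta> \<gamma> :: real
  assumes "\<not> (\<alpha> = 0 \<and> \<beta> = 0 \<and> \<gamma> = 0)"
  obtains k a b c d where "a * d - b * c \<noteq> 0"
    "\<And>p q r. \<alpha> * p + \<beta> * q + \<gamma> * r = 0 \<Longrightarrow> quad_form p q r b d = form_weight k * quad_form p q r a c"
proof -
  consider "\<alpha> \<noteq> 0" | "\<gamma> \<noteq> 0" | "\<alpha> = 0" "\<gamma> = 0" "\<beta> \<noteq> 0" using assms by blast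
  then show ?thesis
  proof cases
    case 1
    obtain k c where "c \<noteq> 0" and c: "(\<beta> / \<alpha>)\<^sup>2 - \<gamma> / \<alpha> = form_weight k * c\<^sup>2"
      by (rule exists_form_weight)
    show ?thesis
    proof (rule that[of 0 "\<beta> / \<alpha>" 1 c k])
      fix p q r assume "\<alpha> * p + \<beta> * q + \<gamma> * r = 0"
      then have "p + \<beta> / \<alpha> * q + \<gamma> / \<alpha> * r = 0" using 1 by (simp add: field_simps)
      then have "p + q * (\<beta> / \<alpha>) + r * (\<beta> / \<alpha>)\<^sup>2 = r * ((\<beta> / \<alpha>)\<^sup>2 - \<gamma> / \<alpha>)"
        by (simp add: algebra_simps)
      then show "quad_form p q r 1 (\<beta> / \<alpha>) = form_weight k * quad_form p q r 0 c"
        unfolding c by (simp add: quad_form_def mult_ac)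
    qed (use \<open>c \<noteq> 0\<close> in simp)
  next
    case 2
    obtain k a where "a \<noteq> 0" and a: "(\<beta> / \<gamma>)\<^sup>2 - \<alpha> / \<gamma> = form_weight k * a\<^sup>2"
      by (rule exists_form_weight)
    show ?thesis
    proof (rule that[of a 1 "\<beta> / \<gamma>" 0 k])
      fix p q r assume "\<alpha> * p + \<beta> * q + \<gamma> * r = 0"
      then have "\<alpha> / \<gamma> * p + \<beta> / \<gamma> * q + r = 0" using 2 by (simp add: field_simps)
      then have "p * (\<beta> / \<gamma>)\<^sup>2 + q * (\<beta> / \<gamma>) + r = p * ((\<beta> / \<gamma>)\<^sup>2 - \<alpha> / \<gamma>)"
        by (simp add: algebra_simps)
      then show "quad_form p q r (\<beta> / \<gamma>) 1 = form_weight k * quad_form p q r a 0"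
        unfolding a by (simp add: quad_form_def mult_ac)
    qed (use \<open>a \<noteq> 0\<close> in simp)
  next
    case 3
    show ?thesis
      by (rule that[of 1 "-1" 1 1 Form2f]) (use 3 in \<open>auto simp: quad_form_def\<close>)
  qed
qed

text \<open>
  The functional that vanishes on the pencil is the cross product of the two coefficient vectors.
  Once it is diagonal, both forms are combinations of \<open>x y\<close> and \<open>form_v k\<close>, and Cramer's rule inverts
  the matrix of these combinations.
\<close>

lemma normalize_pencil:
  assumes indep: "lin_indep_pair (quad_form p q r) (quad_form p' q' r')"
  obtains k a b c d k1 k2 k3 k4 where "a * d - b * c \<noteq> 0" "k1 * k4 - k2 * k3 \<noteq> 0"
    "\<And>x y. k1 * quad_form p q r (a * x + b * y) (c * x + d * y)
         + k2 * quad_form p' q' r' (a * x + b * y) (c * x + d * y) = x * y"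
    "\<And>x y. k3 * quad_form p q r (a * x + b * y) (c * x + d * y)
         + k4 * quad_form p' q' r' (a * x + b * y) (c * x + d * y) = form_v k x y"
proof -
  have ind: "s = 0 \<and> t = 0" if "s * p + t * p' = 0" "s * q + t * q' = 0" "s * r + t * r' = 0" for s t
  proof -
    have "s * quad_form p q r x y + t * quad_form p' q' r' x y
        = (s * p + t * p') * x\<^sup>2 + (s * q + t * q') * x * y + (s * r + t * r') * y\<^sup>2" for x y
      by (simp add: quad_form_def algebra_simps)
    then have "\<forall>x y. s * quad_form p q r x y + t * quad_form p' q' r' x y = 0"
      unfolding that by simp
    then show ?thesis using indep unfolding lin_indep_pair_def by blast
  qed
  define \<alpha> \<beta> \<gamma> where "\<alpha> = q * r' - r * q'" and "\<beta> = r * p' - p * r'" and "\<gamma> = p * q' - q * p'"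
  have "\<not> (\<alpha> = 0 \<and> \<beta> = 0 \<and> \<gamma> = 0)"
  proof
    assume "\<alpha> = 0 \<and> \<beta> = 0 \<and> \<gamma> = 0"
    then have *: "q * r' = r * q'" "r * p' = p * r'" "p * q' = q * p'"
      unfolding \<alpha>_def \<beta>_def \<gamma>_def by auto
    have "p = 0" using ind[of "p'" "- p"] * by (simp add: mult_ac)
    moreover have "q = 0" using ind[of "q'" "- q"] * by (simp add: mult_ac)
    moreover have "r = 0" using ind[of "r'" "- r"] * by (simp add: mult_ac)
    ultimately show False using ind[of 1 0] by simp
  qed
  then obtain k a b c d where det: "a * d - b * c \<noteq> 0"
    and ann: "\<And>p q r. \<alpha> * p + \<beta> * q + \<gamma> * r = 0 \<Longrightarrow>
      quad_form p q r b d = form_weight k * quad_form p q r a c"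
    by (rule diagonalize_annihilator) (rule that)
  define A B where "A = quad_form p q r a c"
    and "B = 2 * p * a * b + q * (a * d + b * c) + 2 * r * c * d"
  define A' B' where "A' = quad_form p' q' r' a c"
    and "B' = 2 * p' * a * b + q' * (a * d + b * c) + 2 * r' * c * d"
  have 1: "quad_form p q r (a * x + b * y) (c * x + d * y) = B * (x * y) + A * form_v k x y" for x y
  proof -
    have "quad_form p q r b d = form_weight k * A"
      unfolding A_def by (rule ann) (simp add: \<alpha>_def \<beta>_def \<gamma>_def algebra_simps)
    then show ?thesis
      unfolding quad_form_linear_change form_v_eq_quad_form A_def[symmetric] B_def[symmetric]
      by (simp add: quad_form_def algebra_simps)
  qed
  have 2: "quad_form p' q' r' (a * x + b * y) (c * x + d * y) = B' * (x * y) + A' * form_v k x y" for x y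
  proof -
    have "quad_form p' q' r' b d = form_weight k * A'"
      unfolding A'_def by (rule ann) (simp add: \<alpha>_def \<beta>_def \<gamma>_def algebra_simps)
    then show ?thesis
      unfolding quad_form_linear_change form_v_eq_quad_form A'_def[symmetric] B'_def[symmetric]
      by (simp add: quad_form_def algebra_simps)
  qed
  \<comment> \<open>A substitution is surjective, so the two transformed forms are still independent.\<close>
  have ind': "s = 0 \<and> t = 0" if "s * A + t * A' = 0" "s * B + t * B' = 0" for s t
  proof -
    have "s * quad_form p q r X Y + t * quad_form p' q' r' X Y = 0" for X Y
    proof -
      define e where "e = a * d - b * c"
      have "e \<noteq> 0" using det by (simp add: e_def)
      define x y where "x = (d * X - b * Y) / e" and "y = (a * Y - c * X) / e"
      have XY: "X = a * x + b * y" "Y = c * x + d * y"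
        unfolding x_def y_def using \<open>e \<noteq> 0\<close> by (auto simp: field_simps) (auto simp: e_def algebra_simps)
      have "s * quad_form p q r X Y + t * quad_form p' q' r' X Y
          = (s * B + t * B') * (x * y) + (s * A + t * A') * form_v k x y"
        unfolding XY 1 2 by (simp add: algebra_simps)
      then show ?thesis using that by simp
    qed
    then show ?thesis using indep unfolding lin_indep_pair_def by blast
  qed
  define \<delta> where "\<delta> = A' * B - A * B'"
  have "\<delta> \<noteq> 0"
  proof
    assume "\<delta> = 0"
    then have *: "A' * B = A * B'" by (simp add: \<delta>_def)
    have "A = 0" using ind'[of "A'" "- A"] * by (simp add: mult_ac)
    moreover have "B = 0" using ind'[of "B'" "- B"] * by (simp add: mult_ac)
    ultimately show False using ind'[of 1 0] by simp
  qed
  show ?thesis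
  proof (rule that[of a d b c "A' / \<delta>" "B / \<delta>" "- A / \<delta>" "- B' / \<delta>" k])
    show "a * d - b * c \<noteq> 0" by (rule det)
    have "A' / \<delta> * (B / \<delta>) - - A / \<delta> * (- B' / \<delta>) = (A' * B - A * B') / \<delta>\<^sup>2"
      by (simp add: power2_eq_square diff_divide_distrib)
    then show "A' / \<delta> * (B / \<delta>) - - A / \<delta> * (- B' / \<delta>) \<noteq> 0"
      using \<open>\<delta> \<noteq> 0\<close> by (simp flip: \<delta>_def)
    fix x y
    have "A' * (B * (x * y) + A * form_v k x y) - A * (B' * (x * y) + A' * form_v k x y) = \<delta> * (x * y)"
      "B * (B' * (x * y) + A' * form_v k x y) - B' * (B * (x * y) + A * form_v k x y) = \<delta> * form_v k x y"
      by (simp_all add: \<delta>_def algebra_simps)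
    then show "A' / \<delta> * quad_form p q r (a * x + b * y) (c * x + d * y)
        + - A / \<delta> * quad_form p' q' r' (a * x + b * y) (c * x + d * y) = x * y"
      "- B' / \<delta> * quad_form p q r (a * x + b * y) (c * x + d * y)
        + B / \<delta> * quad_form p' q' r' (a * x + b * y) (c * x + d * y) = form_v k x y"
      unfolding 1 2 using \<open>\<delta> \<noteq> 0\<close> by (simp_all add: field_simps)
  qed
qed

text \<open>
  The form \<open>m X Y + s (X\<^sup>2 + w' Y\<^sup>2)\<close> has discriminant \<open>m\<^sup>2 - 4 w' s\<^sup>2\<close>, and substituting
  \<open>(X, Y) = (a x + b y, c x + d y)\<close> multiplies it by \<open>(a d - b c)\<^sup>2\<close>. Computing it also from the expression
  in \<open>x y\<close> and \<open>form_v k\<close> gives two binary forms in \<open>(m, s)\<close> that must agree. The claim is the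
  equality of their determinants.
\<close>

lemma pencil_discriminant:
  assumes xy: "\<And>x y. q11 * (x * y) + q12 * form_v k x y = (a * x + b * y) * (c * x + d * y)"
    and v: "\<And>x y. q21 * (x * y) + q22 * form_v k x y = form_v l (a * x + b * y) (c * x + d * y)"
  shows "form_weight l * (a * d - b * c) ^ 4 = form_weight k * (q11 * q22 - q12 * q21)\<^sup>2"
proof -
  define w w' where "w = form_weight k" and "w' = form_weight l"
  have c1: "q12 = a * c" "q12 * w = b * d" "q11 = a * d + b * c"
    using xy[of 1 0] xy[of 0 1] xy[of 1 1] unfolding form_v_eq_quad_form quad_form_def w_def
    by (simp_all add: algebra_simps)
  have c2: "q22 = a\<^sup>2 + w' * c\<^sup>2" "q22 * w = b\<^sup>2 + w' * d\<^sup>2" "q21 = 2 * (a * b + w' * c * d)"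
    using v[of 1 0] v[of 0 1] v[of 1 1] unfolding form_v_eq_quad_form quad_form_def w_def w'_def
    by (simp_all add: algebra_simps power2_eq_square)
  \<comment> \<open>The coefficients of \<open>m\<^sup>2\<close>, \<open>s\<^sup>2\<close> and, up to the factor 2, \<open>m s\<close>.\<close>
  have d1: "q11\<^sup>2 - 4 * w * q12\<^sup>2 = (a * d - b * c)\<^sup>2"
    using c1 by algebra
  have d2: "q21\<^sup>2 - 4 * w * q22\<^sup>2 = - 4 * w' * (a * d - b * c)\<^sup>2"
    using c2 by algebra
  have d3: "q11 * q21 - 4 * w * q12 * q22 = 0"
    using c1 c2 by algebra
  have "4 * (w' * (a * d - b * c) ^ 4)
      = - ((a * d - b * c)\<^sup>2 * (- 4 * w' * (a * d - b * c)\<^sup>2))" by algebra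
  also have "\<dots> = (q11 * q21 - 4 * w * q12 * q22)\<^sup>2 - (q11\<^sup>2 - 4 * w * q12\<^sup>2) * (q21\<^sup>2 - 4 * w * q22\<^sup>2)"
    unfolding d1 d2 d3 by simp
  also have "\<dots> = 4 * (w * (q11 * q22 - q12 * q21)\<^sup>2)" by algebra
  finally show ?thesis unfolding w_def w'_def by simp
qed

text \<open>
  The relation between the weights has the form \<open>w\<^sub>l D = w\<^sub>k E\<close> with \<open>D, E > 0\<close>, which is impossible
  for distinct weights in \<open>{0, 1, -1}\<close>. Positivity needs both diagonal blocks of \<open>A\<close> to be
  invertible. As the lower left block of \<open>A\<close> is zero, the upper left block of \<open>A\<^sup>-\<^sup>1 A = 1\<close> and the lower
  right block of \<open>A A\<^sup>-\<^sup>1 = 1\<close> exhibit their inverses.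
\<close>

lemma forms_not_equivalent:
  assumes "k \<noteq> l" and S: "has_form k F G" and T: "has_form l F' G'"
  shows "\<not> germs_equivalent (graph_surface F G) (graph_surface F' G')"
proof
  assume "germs_equivalent (graph_surface F G) (graph_surface F' G')"
  then obtain A :: "real^4^4" where "invertible A"
    and maps: "maps_germ A (graph_surface F G) (graph_surface F' G')"
    unfolding germs_equivalent_def by blast
  have F: "O_xy 3 (\<lambda>x y. F x y - quad_form 0 1 0 x y)"
    and G: "O_xy 3 (\<lambda>x y. G x y - quad_form 1 0 (form_weight k) x y)"
    using S unfolding has_form_def form_v_eq_quad_form xy_eq_quad_form[symmetric] by blast+
  have F': "O_xy 3 (\<lambda>x y. F' x y - quad_form 0 1 0 x y)"
    and G': "O_xy 3 (\<lambda>x y. G' x y - quad_form 1 0 (form_weight l) x y)"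
    using T unfolding has_form_def form_v_eq_quad_form xy_eq_quad_form[symmetric] by blast+
  have on_T: "z $ 3 = F' (z $ 1) (z $ 2)" "z $ 4 = G' (z $ 1) (z $ 2)" if "z \<in> graph_surface F' G'" for z
    using that unfolding mem_graph_surface by auto
  note u = second_order_of_germ_map[OF F G F' maps on_T(1)]
  note v = second_order_of_germ_map[OF F G G' maps on_T(2)]
  have disc: "form_weight l * (A$1$1 * A$2$2 - A$1$2 * A$2$1) ^ 4
      = form_weight k * (A$3$3 * A$4$4 - A$3$4 * A$4$3)\<^sup>2"
    by (rule pencil_discriminant)
      (use u(3) v(3) in \<open>simp_all add: form_v_eq_quad_form fun_cong[OF fun_cong[OF xy_eq_quad_form]]\<close>)
  obtain B :: "real^4^4" where B: "A ** B = mat 1" "B ** A = mat 1"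
    using \<open>invertible A\<close> unfolding invertible_def by blast
  have BA: "(\<Sum>m\<in>UNIV. B$i$m * A$m$j) = (if i = j then 1 else 0)" for i j
    using B(2) by (simp add: matrix_matrix_mult_def mat_def vec_eq_iff)
  have AB: "(\<Sum>m\<in>UNIV. A$i$m * B$m$j) = (if i = j then 1 else 0)" for i j
    using B(1) by (simp add: matrix_matrix_mult_def mat_def vec_eq_iff)
  have "B$1$1 * A$1$1 + B$1$2 * A$2$1 = 1" "B$1$1 * A$1$2 + B$1$2 * A$2$2 = 0"
    "B$2$1 * A$1$1 + B$2$2 * A$2$1 = 0" "B$2$1 * A$1$2 + B$2$2 * A$2$2 = 1"
    using BA[of 1 1] BA[of 1 2] BA[of 2 1] BA[of 2 2] u(1,2) v(1,2) by (simp_all add: sum_4)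
  then have "(B$1$1 * B$2$2 - B$1$2 * B$2$1) * (A$1$1 * A$2$2 - A$1$2 * A$2$1) = 1" by algebra
  then have P: "A$1$1 * A$2$2 - A$1$2 * A$2$1 \<noteq> 0" by auto
  have "A$3$3 * B$3$3 + A$3$4 * B$4$3 = 1" "A$3$3 * B$3$4 + A$3$4 * B$4$4 = 0"
    "A$4$3 * B$3$3 + A$4$4 * B$4$3 = 0" "A$4$3 * B$3$4 + A$4$4 * B$4$4 = 1"
    using AB[of 3 3] AB[of 3 4] AB[of 4 3] AB[of 4 4] u(1,2) v(1,2) by (simp_all add: sum_4)
  then have "(A$3$3 * A$4$4 - A$3$4 * A$4$3) * (B$3$3 * B$4$4 - B$3$4 * B$4$3) = 1" by algebra
  then have Q: "A$3$3 * A$4$4 - A$3$4 * A$4$3 \<noteq> 0" by auto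
  define D E where "D = (A$1$1 * A$2$2 - A$1$2 * A$2$1) ^ 4"
    and "E = (A$3$3 * A$4$4 - A$3$4 * A$4$3)\<^sup>2"
  have "D > 0" "E > 0" using P Q unfolding D_def E_def by (simp_all add: zero_less_power_eq)
  then show False
    using disc \<open>k \<noteq> l\<close> unfolding D_def[symmetric] E_def[symmetric] by (cases k; cases l) auto
qed

lemma exists_normal_form:
  assumes F: "O_xy 3 (\<lambda>x y. F x y - quad_form f20 f11 f02 x y)"
    and G: "O_xy 3 (\<lambda>x y. G x y - quad_form g20 g11 g02 x y)"
    and indep: "lin_indep_pair (quad_form f20 f11 f02) (quad_form g20 g11 g02)"
  shows "\<exists>k F' G'. has_form k F' G' \<and>
    germs_equivalent (graph_surface F G) (graph_surface F' G')"
proof -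
  obtain k a b c d k1 k2 k3 k4 where det: "a * d - b * c \<noteq> 0" "k1 * k4 - k2 * k3 \<noteq> 0"
    and u: "\<And>x y. k1 * quad_form f20 f11 f02 (a * x + b * y) (c * x + d * y)
         + k2 * quad_form g20 g11 g02 (a * x + b * y) (c * x + d * y) = x * y"
    and v: "\<And>x y. k3 * quad_form f20 f11 f02 (a * x + b * y) (c * x + d * y)
         + k4 * quad_form g20 g11 g02 (a * x + b * y) (c * x + d * y) = form_v k x y"
    by (rule normalize_pencil[OF indep]) (rule that)
  define comb where "comb = (\<lambda>s t x y.
    s * F (a * x + b * y) (c * x + d * y) + t * G (a * x + b * y) (c * x + d * y))"
  have "O_xy 3 (\<lambda>x y. comb s t x y
      - (s * quad_form f20 f11 f02 (a * x + b * y) (c * x + d * y)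
       + t * quad_form g20 g11 g02 (a * x + b * y) (c * x + d * y)))" for s t
    using O_xy_linear_combination[OF O_xy_linear_change[OF F, of a b c d] O_xy_linear_change[OF G, of a b c d], of s t]
    by (simp add: comb_def algebra_simps)
  from this[of k1 k2] this[of k3 k4] have "has_form k (comb k1 k2) (comb k3 k4)"
    unfolding has_form_def u v by blast
  moreover have "germs_equivalent (graph_surface F G) (graph_surface (comb k1 k2) (comb k3 k4))"
    unfolding comb_def by (rule block_linear_change_of_graph[OF det])
  ultimately show ?thesis by blast
qed

section \<open>Classification of nonparallel germs at order 2\<close>

theorem proposition21p4:
  "(\<forall>(F :: real \<Rightarrow> real \<Rightarrow> real) (G :: real \<Rightarrow> real \<Rightarrow> real)
      (f20 :: real) (f11 :: real) (f02 :: real) (g20 :: real) (g11 :: real) (g02 :: real).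
      real_analytic_germ F \<longrightarrow> real_analytic_germ G \<longrightarrow>
      O_xy 3 (\<lambda>x y. F x y - quad_form f20 f11 f02 x y) \<longrightarrow>
      O_xy 3 (\<lambda>x y. G x y - quad_form g20 g11 g02 x y) \<longrightarrow>
      lin_indep_pair (quad_form f20 f11 f02) (quad_form g20 g11 g02) \<longrightarrow>
      (\<exists>k F' G'. has_form k F' G' \<and>
         germs_equivalent (graph_surface F G) (graph_surface F' G')))
   \<and>
   (\<forall>k l F G F' G'. k \<noteq> l \<longrightarrow> has_form k F G \<longrightarrow> has_form l F' G' \<longrightarrow>
      \<not> germs_equivalent (graph_surface F G) (graph_surface F' G'))"
  by (intro conjI allI impI exists_normal_form forms_not_equivalent) assumption+

end
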